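(* Let $N\ge 2$. For every $\mathbf{x}\in\mathbb{X}^N$, $$\mathcal{F}(\Phi(\mathbf{x}))=-i\,\Phi(\mathcal{F}_d(\mathcal{S}_d(\mathbf{x})))=-i\,\Phi(\mathcal{F}_d^{-1}(\mathbf{x})).$$
   Context: $\mathbb{X}^N$ is the set of $\mathbf{x}=(x_0,\dots,x_{N-1})\in\mathbb{C}^N$ with $x_0=0$ and $\sum_{n=1}^{N-1}x_n=0$. $\mathcal{F}_d:\mathbb{X}^N\to\mathbb{X}^N$ is the normalized discrete Fourier transform $\mathcal{F}_d(\mathbf{x})_k=\frac{1}{\sqrt N}\sum_{n=0}^{N-1}x_ne^{-2\pi ikn/N}$, and $\mathcal{S}_d:\mathbb{X}^N\to\mathbb{X}^N$ is $\mathcal{S}_d(\mathbf{x})_k=x_{N-k}$ (indices mod $N$); $\mathcal{F}_d$ is a bijection of $\mathbb{X}^N$. For $\mathbf{x}\in\mathbb{X}^N$, $\Phi(\mathbf{x})$ is the function on $\mathbb{R}$ given by $\Phi(\mathbf{x})(t)=\dfrac{\sum_{k=1}^{N-1}x_ke^{2\pi kt/\sqrt N}}{1-e^{2\pi t\sqrt N}}$ (extended continuously at $t=0$). For an integrable $f$ on $\mathbb{R}$, $\mathcal{F}(f)(x)=\int_{\mathbb{R}}f(t)e^{-2\pi ixt}dt$. *)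

theory Defs
  imports "HOL-Analysis.Analysis"
begin

(* A vector in C^N is a function on nat that vanishes from N on. This makes the representation
   unique, so that equality of vectors is equality of functions and the inverse of the discrete
   Fourier transform on the space below is well defined. *)
definition X_space :: "nat \<Rightarrow> (nat \<Rightarrow> complex) set" where
  "X_space N = {x. (\<forall>n\<ge>N. x n = 0) \<and> x 0 = 0 \<and> (\<Sum>n=1..N-1. x n) = 0}"

definition dft :: "nat \<Rightarrow> (nat \<Rightarrow> complex) \<Rightarrow> nat \<Rightarrow> complex" where
  "dft N x = (\<lambda>k. if k < N then
     1 / complex_of_real (sqrt (real N)) *
       (\<Sum>n<N. x n * exp (- (2 * complex_of_real pi * \<i> * of_nat k * of_nat n / of_nat N)))
     else 0)"

definition dft_inv :: "nat \<Rightarrow> (nat \<Rightarrow> complex) \<Rightarrow> nat \<Rightarrow> complex" where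
  "dft_inv N = inv_into (X_space N) (dft N)"

definition reflect :: "nat \<Rightarrow> (nat \<Rightarrow> complex) \<Rightarrow> nat \<Rightarrow> complex" where
  "reflect N x = (\<lambda>k. if k < N then x ((N - k) mod N) else 0)"

definition Phi_quot :: "nat \<Rightarrow> (nat \<Rightarrow> complex) \<Rightarrow> real \<Rightarrow> complex" where
  "Phi_quot N x t =
     (\<Sum>k=1..N-1. x k * complex_of_real (exp (2 * pi * real k * t / sqrt (real N))))
       / complex_of_real (1 - exp (2 * pi * t * sqrt (real N)))"

(* The quotient has a removable singularity at 0 for x in X_space N. *)
definition Phi :: "nat \<Rightarrow> (nat \<Rightarrow> complex) \<Rightarrow> real \<Rightarrow> complex" where
  "Phi N x t = (if t = 0 then Lim (at 0) (Phi_quot N x) else Phi_quot N x t)"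

(* Only meaningful for integrable f: the library's integral is 0 otherwise. *)
definition fourier :: "(real \<Rightarrow> complex) \<Rightarrow> real \<Rightarrow> complex" where
  "fourier f \<xi> =
     (\<integral>t. f t * exp (- (2 * complex_of_real pi * \<i> * complex_of_real \<xi> * complex_of_real t)) \<partial>lborel)"

end

theory Submission
  imports Defs "HOL-Complex_Analysis.Complex_Analysis"
begin

text \<open>
  The function $g(z) = \Phi(x)(z) e^{-2\pi i \xi z}$ satisfies $g(z + i\sqrt N) = e^{2\pi\xi\sqrt N} g(z)$ and
  decays like $e^{-2\pi|\mathrm{Re}\, z|/\sqrt N}$. Integrating it over the boundary of the rectangle
  $[-R, R] \times [0, \sqrt N]$ and letting $R \to \infty$ therefore gives
  $(1 - e^{2\pi\xi\sqrt N})\, \mathcal F(\Phi(x))(\xi)$. The poles inside are the points $i m/\sqrt N$ with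
  $1 \le m < N$, because $\sum_k x_k = 0$ removes those at $0$ and $i\sqrt N$, and their residues are the
  entries of the inverse discrete Fourier transform of $x$ times exponentials: the residue theorem
  yields the numerator of $-i\,\Phi(\mathcal F_d^{-1}(x))(\xi)$. The point $\xi = 0$ follows by continuity.
\<close>

subsection \<open>Inversion of the discrete Fourier transform\<close>

lemma X_spaceD:
  assumes "x \<in> X_space N"
  shows X_space_beyond: "\<And>n. n \<ge> N \<Longrightarrow> x n = 0" and X_space_0: "x 0 = 0"
    and X_space_sum: "(\<Sum>n<N. x n) = 0"
proof -
  show *: "x 0 = 0" and "\<And>n. n \<ge> N \<Longrightarrow> x n = 0"
    using assms by (auto simp: X_space_def)
  show "(\<Sum>n<N. x n) = 0"
  proof (cases "N = 0")
    case False
    then have "{..<N} = insert 0 {1..N-1}" by auto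
    then show ?thesis using assms * by (simp add: X_space_def)
  qed simp
qed

lemma X_spaceI:
  assumes "\<And>n. n \<ge> N \<Longrightarrow> x n = 0" "x 0 = 0" "(\<Sum>n<N. x n) = 0"
  shows "x \<in> X_space N"
proof (cases "N = 0")
  case False
  then have "{..<N} = insert 0 {1..N-1}" by auto
  then show ?thesis using assms by (simp add: X_space_def)
qed (use assms in \<open>auto simp: X_space_def\<close>)

lemma exp_2pi_i_of_nat: "exp (2 * complex_of_real pi * \<i> * of_nat k) = 1"
  by (metis exp_of_nat2_mult exp_two_pi_i mult.commute power_one)

text \<open>The map \<open>n \<mapsto> (N - n) mod N\<close> is an involution of the index set that
  flips the sign of the exponent modulo \<open>2 pi i k\<close>. Transforming the reflection thus
  gives the sum with the positive exponent, the candidate for the inverse transform.\<close>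

lemma dft_reflect:
  assumes "k < N"
  shows "dft N (reflect N x) k = 1 / complex_of_real (sqrt (real N)) *
    (\<Sum>n<N. x n * exp (2 * complex_of_real pi * \<i> * of_nat k * of_nat n / of_nat N))"
proof -
  have inv: "(N - (N - n) mod N) mod N = n" if "n < N" for n
    using that by (cases "n = 0") auto
  have "(\<Sum>n<N. reflect N x n * exp (- (2 * complex_of_real pi * \<i> * of_nat k * of_nat n / of_nat N)))
      = (\<Sum>n<N. x n * exp (2 * complex_of_real pi * \<i> * of_nat k * of_nat n / of_nat N))"
  proof (rule sum.reindex_bij_witness[of _ "\<lambda>n. (N - n) mod N" "\<lambda>n. (N - n) mod N"])
    fix n assume n: "n \<in> {..<N}"
    have "exp (2 * complex_of_real pi * \<i> * of_nat k * of_nat ((N - n) mod N) / of_nat N)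
        = exp (- (2 * complex_of_real pi * \<i> * of_nat k * of_nat n / of_nat N))"
    \<comment> \<open>The index 0 is its own reflection, with exponent 0; for every other index the
      two exponents differ by exactly \<open>2 pi i k\<close>.\<close>
    proof (cases "n = 0")
      case False
      with n have "2 * complex_of_real pi * \<i> * of_nat k * of_nat ((N - n) mod N) / of_nat N
          = - (2 * complex_of_real pi * \<i> * of_nat k * of_nat n / of_nat N) + 2 * complex_of_real pi * \<i> * of_nat k"
        by (simp add: of_nat_diff field_simps)
      then show ?thesis using exp_2pi_i_of_nat[of k] by (simp add: exp_diff exp_minus divide_inverse)
    qed simp
    then show "x ((N - n) mod N) * exp (2 * complex_of_real pi * \<i> * of_nat k * of_nat ((N - n) mod N) / of_nat N)
        = reflect N x n * exp (- (2 * complex_of_real pi * \<i> * of_nat k * of_nat n / of_nat N))"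
      using n by (simp add: reflect_def)
  qed (use inv in auto)
  then show ?thesis using assms by (simp add: dft_def)
qed

text \<open>The terms are the powers of \<open>exp (2 pi i (n - m) / N)\<close>, an
  \<open>N\<close>-th root of unity that is 1 only if \<open>n = m\<close>, both indices being below
  \<open>N\<close>. Otherwise the geometric sum vanishes.\<close>

lemma sum_roots_unity_orthogonal:
  assumes "n < N" "m < N"
  shows "(\<Sum>k<N. exp (2 * complex_of_real pi * \<i> * of_nat k * of_nat n / of_nat N)
      * exp (- (2 * complex_of_real pi * \<i> * of_nat m * of_nat k / of_nat N)))
    = (if n = m then of_nat N else 0)"
proof -
  define z where "z = exp (2 * complex_of_real pi * \<i> * (of_nat n - of_nat m) / of_nat N)"
  have "exp (2 * complex_of_real pi * \<i> * of_nat k * of_nat n / of_nat N)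
      * exp (- (2 * complex_of_real pi * \<i> * of_nat m * of_nat k / of_nat N)) = z ^ k" for k
    by (simp add: z_def exp_of_nat_mult[symmetric] exp_add[symmetric] field_simps)
       (simp add: algebra_simps diff_divide_distrib)
  then have eq: "(\<Sum>k<N. exp (2 * complex_of_real pi * \<i> * of_nat k * of_nat n / of_nat N)
      * exp (- (2 * complex_of_real pi * \<i> * of_nat m * of_nat k / of_nat N))) = (\<Sum>k<N. z ^ k)"
    by simp
  show ?thesis
  proof (cases "n = m")
    case True
    then show ?thesis unfolding eq by (simp add: z_def)
  next
    case False
    have "of_nat N * (2 * complex_of_real pi * \<i> * (of_nat n - of_nat m) / of_nat N)
        = 2 * complex_of_real pi * \<i> * of_nat n - 2 * complex_of_real pi * \<i> * of_nat m"
      using assms(1) by (simp add: right_diff_distrib[symmetric])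
    then have "z ^ N = 1"
      unfolding z_def exp_of_nat_mult[symmetric] by (simp add: exp_diff exp_2pi_i_of_nat)
    moreover have "z \<noteq> 1"
    proof
      assume "z = 1"
      then have "exp (2 * complex_of_real pi * \<i> * of_nat n / of_nat N)
          = exp (2 * complex_of_real pi * \<i> * of_nat m / of_nat N)"
        by (simp add: z_def exp_diff right_diff_distrib diff_divide_distrib)
      then have "n mod N = m mod N"
        using complex_root_unity_eq[of N n m] assms by auto
      with False assms show False by simp
    qed
    ultimately show ?thesis using False unfolding eq by (simp add: geometric_sum)
  qed
qed

text \<open>Exchanging the two sums leaves the orthogonality relation, and the two normalizations
  combine to \<open>1 / N\<close>. The hypothesis gives equality at indices from \<open>N\<close>
  on, where \<open>dft\<close> is 0.\<close>

lemma dft_dft_reflect: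
  assumes "\<And>n. n \<ge> N \<Longrightarrow> x n = 0"
  shows "dft N (dft N (reflect N x)) = x"
proof
  fix j
  show "dft N (dft N (reflect N x)) j = x j"
  proof (cases "j < N")
    case True
    let ?s = "complex_of_real (sqrt (real N))"
    let ?e = "\<lambda>k n. exp (2 * complex_of_real pi * \<i> * of_nat k * of_nat n / of_nat N)"
    let ?f = "\<lambda>k n. exp (- (2 * complex_of_real pi * \<i> * of_nat k * of_nat n / of_nat N))"
    have s: "?s * ?s = of_nat N" by (simp flip: of_real_mult)
    have "dft N (dft N (reflect N x)) j = 1 / ?s * (\<Sum>k<N. 1 / ?s * (\<Sum>n<N. x n * ?e k n) * ?f j k)"
      using True by (simp add: dft_def[of N "dft N (reflect N x)"] dft_reflect)
    also have "\<dots> = 1 / (?s * ?s) * (\<Sum>k<N. \<Sum>n<N. x n * (?e k n * ?f j k))"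
      by (simp add: sum_distrib_left sum_distrib_right algebra_simps)
    also have "\<dots> = 1 / of_nat N * (\<Sum>n<N. x n * (\<Sum>k<N. ?e k n * ?f j k))"
      unfolding s by (subst sum.swap) (simp add: sum_distrib_left)
    also have "(\<Sum>n<N. x n * (\<Sum>k<N. ?e k n * ?f j k)) = (\<Sum>n<N. if n = j then x n * of_nat N else 0)"
      by (intro sum.cong refl) (use True in \<open>simp add: sum_roots_unity_orthogonal\<close>)
    finally show ?thesis using True by simp
  qed (use assms in \<open>simp add: dft_def\<close>)
qed

text \<open>The same computation in the other order provides a left inverse of \<open>dft\<close>,
  hence its injectivity.\<close>

lemma dft_reflect_dft:
  assumes "\<And>n. n \<ge> N \<Longrightarrow> x n = 0"
  shows "dft N (reflect N (dft N x)) = x"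
proof
  fix j
  show "dft N (reflect N (dft N x)) j = x j"
  proof (cases "j < N")
    case True
    let ?s = "complex_of_real (sqrt (real N))"
    let ?e = "\<lambda>k n. exp (2 * complex_of_real pi * \<i> * of_nat k * of_nat n / of_nat N)"
    let ?f = "\<lambda>k n. exp (- (2 * complex_of_real pi * \<i> * of_nat k * of_nat n / of_nat N))"
    have s: "?s * ?s = of_nat N" by (simp flip: of_real_mult)
    have "dft N (reflect N (dft N x)) j = 1 / ?s * (\<Sum>k<N. 1 / ?s * (\<Sum>n<N. x n * ?f k n) * ?e j k)"
      using True by (subst dft_reflect) (simp_all add: dft_def)
    also have "\<dots> = 1 / (?s * ?s) * (\<Sum>k<N. \<Sum>n<N. x n * (?e k j * ?f n k))"
      by (simp add: sum_distrib_left sum_distrib_right algebra_simps)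
    also have "\<dots> = 1 / of_nat N * (\<Sum>n<N. x n * (\<Sum>k<N. ?e k j * ?f n k))"
      unfolding s by (subst sum.swap) (simp add: sum_distrib_left)
    also have "(\<Sum>n<N. x n * (\<Sum>k<N. ?e k j * ?f n k)) = (\<Sum>n<N. if n = j then x n * of_nat N else 0)"
      by (intro sum.cong refl) (use True in \<open>simp add: sum_roots_unity_orthogonal\<close>)
    finally show ?thesis using True by simp
  qed (use assms in \<open>simp add: dft_def\<close>)
qed

text \<open>The transform interchanges the two conditions that define the space: entry 0 of a
  transform is the sum of the original entries divided by \<open>sqrt N\<close>. So the zero sum of
  \<open>x\<close> gives \<open>?y 0 = 0\<close>, and \<open>x 0 = 0\<close> gives the zero sum of
  \<open>?y\<close>, because \<open>dft N ?y = x\<close>.\<close>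

lemma dft_reflect_in_X_space:
  assumes "x \<in> X_space N"
  shows "dft N (reflect N x) \<in> X_space N"
proof (cases "N = 0")
  case False
  let ?y = "dft N (reflect N x)"
  have "dft N ?y 0 = 1 / complex_of_real (sqrt (real N)) * (\<Sum>n<N. ?y n)"
    using False by (subst dft_def) simp
  then have "(\<Sum>n<N. ?y n) = 0"
    using False X_space_0[OF assms] by (simp add: dft_dft_reflect X_space_beyond[OF assms])
  then show ?thesis
    using False X_space_sum[OF assms] by (intro X_spaceI) (simp_all add: dft_reflect, simp add: dft_def)
qed (use assms in \<open>simp add: X_space_def dft_def\<close>)

lemma dft_inv_eq:
  assumes "x \<in> X_space N"
  shows "dft_inv N x = dft N (reflect N x)"
  unfolding dft_inv_def
proof (rule inv_into_f_eq)
  show "inj_on (dft N) (X_space N)"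
    by (rule inj_on_inverseI[of _ "\<lambda>y. dft N (reflect N y)"]) (simp add: dft_reflect_dft X_space_beyond)
  show "dft N (dft N (reflect N x)) = x"
    using assms by (simp add: dft_dft_reflect X_space_beyond)
qed (rule dft_reflect_in_X_space[OF assms])

subsection \<open>Continuity and decay of the quotient\<close>

text \<open>
  By Abel summation the numerator is $\sum_j x_j w^j$ divided by $1 - w$, and the denominator is
  $1 - w^N$ divided by $1 - w$. Cancelling this factor removes the singularity of the quotient at
  $w = 1$, so no limit has to be taken at \<open>t = 0\<close> or on the edges of the contour.
\<close>

definition quot_poly :: "nat \<Rightarrow> (nat \<Rightarrow> complex) \<Rightarrow> complex \<Rightarrow> complex" where
  "quot_poly N x w = (\<Sum>j<N. (\<Sum>k\<le>j. x k) * w ^ j) / (\<Sum>j<N. w ^ j)"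

text \<open>Abel summation: \<open>w ^ j\<close> receives the difference of consecutive partial
  sums, which is \<open>x j\<close>. The boundary term at \<open>w ^ N\<close> vanishes for vectors
  in \<open>X_space N\<close>.\<close>

lemma one_minus_mult_partial_sums:
  fixes x :: "nat \<Rightarrow> 'a::comm_ring_1"
  shows "(1 - w) * (\<Sum>j<N. (\<Sum>k\<le>j. x k) * w ^ j) = (\<Sum>j<N. x j * w ^ j) - (\<Sum>j<N. x j) * w ^ N"
proof (induction N)
  case (Suc N)
  have "(\<Sum>k\<le>N. x k) = (\<Sum>j<N. x j) + x N"
    by (simp flip: lessThan_Suc_atMost)
  then have "(1 - w) * (\<Sum>j<Suc N. (\<Sum>k\<le>j. x k) * w ^ j)
      = ((\<Sum>j<N. x j * w ^ j) - (\<Sum>j<N. x j) * w ^ N) + (1 - w) * ((\<Sum>j<N. x j) + x N) * w ^ N"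
    unfolding sum.lessThan_Suc distrib_left[of "1 - w" _ "_ * w ^ N"] Suc by (simp add: mult.assoc)
  then show ?case by (simp add: algebra_simps)
qed simp

text \<open>Numerator and denominator are both multiplied by \<open>1 - w\<close>. At the remaining
  \<open>N\<close>-th roots of unity both denominators vanish and both sides are 0 by
  convention.\<close>

lemma quot_poly_eq:
  assumes "x \<in> X_space N" "w \<noteq> 1"
  shows "quot_poly N x w = (\<Sum>j<N. x j * w ^ j) / (1 - w ^ N)"
proof -
  have "(\<Sum>j<N. x j * w ^ j) / (1 - w ^ N)
      = ((1 - w) * (\<Sum>j<N. (\<Sum>k\<le>j. x k) * w ^ j)) / ((1 - w) * (\<Sum>j<N. w ^ j))"
    using X_space_sum[OF assms(1)] by (simp add: one_minus_mult_partial_sums one_diff_power_eq)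
  then show ?thesis using assms(2) by (simp add: quot_poly_def)
qed

section \<open>Bounds for the quotient in the plane and on the real line\<close>

text \<open>The numerator has degree at most \<open>N - 1\<close>, while
  \<open>norm w \<ge> 2\<close> keeps the denominator above half of
  \<open>norm w ^ N\<close>.\<close>

lemma norm_quot_poly_large:
  assumes "x \<in> X_space N" "norm w \<ge> 2" "N > 0"
  shows "norm (quot_poly N x w) \<le> 2 * (\<Sum>j<N. norm (x j)) / norm w"
proof -
  let ?S = "\<Sum>j<N. norm (x j)"
  have "w \<noteq> 1" and w0: "w \<noteq> 0" using assms(2) by auto
  have pw: "norm w ^ N = norm w * norm w ^ (N - 1)"
    using assms(3) by (simp add: power_eq_if)
  have "norm (\<Sum>j<N. x j * w ^ j) \<le> (\<Sum>j<N. norm (x j) * norm w ^ (N - 1))"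
    using assms by (intro sum_norm_le) (auto simp: norm_mult norm_power intro!: mult_left_mono power_increasing)
  then have num: "norm (\<Sum>j<N. x j * w ^ j) \<le> ?S * norm w ^ (N - 1)"
    by (simp add: sum_distrib_right)
  have "2 \<le> norm w ^ N"
    using power_increasing[of 1 N "norm w"] assms by simp
  moreover have "norm w ^ N - 1 \<le> norm (1 - w ^ N)"
    using norm_triangle_ineq2[of "w ^ N" 1] by (simp add: norm_minus_commute norm_power)
  ultimately have den: "norm w * norm w ^ (N - 1) / 2 \<le> norm (1 - w ^ N)"
    unfolding pw by linarith
  have "norm (quot_poly N x w) \<le> (?S * norm w ^ (N - 1)) / (norm w * norm w ^ (N - 1) / 2)"
    unfolding quot_poly_eq[OF assms(1) \<open>w \<noteq> 1\<close>] norm_divide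
    using num den w0 by (intro frac_le) (simp_all add: sum_nonneg)
  also have "\<dots> = 2 * ?S / norm w"
    using assms(2) by (auto simp: field_simps)
  finally show ?thesis .
qed

text \<open>Because \<open>x 0 = 0\<close>, every term of the numerator contains a factor
  \<open>w\<close>; the denominator stays at least \<open>1 / 2\<close> in norm.\<close>

lemma norm_quot_poly_small:
  assumes "x \<in> X_space N" "norm w \<le> 1 / 2" "N > 0"
  shows "norm (quot_poly N x w) \<le> 2 * (\<Sum>j<N. norm (x j)) * norm w"
proof -
  let ?S = "\<Sum>j<N. norm (x j)"
  have "w \<noteq> 1" using assms(2) by auto
  have *: "norm w ^ j \<le> norm w" if "j \<noteq> 0" for j
    using power_decreasing[of 1 j "norm w"] that assms(2) by simp
  have "norm (\<Sum>j<N. x j * w ^ j) \<le> (\<Sum>j<N. norm (x j) * norm w)"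
  proof (rule sum_norm_le)
    fix j show "norm (x j * w ^ j) \<le> norm (x j) * norm w"
      using X_space_0[OF assms(1)] * by (cases "j = 0") (auto simp: norm_mult norm_power mult_left_mono)
  qed
  then have num: "norm (\<Sum>j<N. x j * w ^ j) \<le> ?S * norm w"
    by (simp add: sum_distrib_right)
  have "norm (w ^ N) \<le> 1 / 2"
    using *[of N] assms by (simp add: norm_power)
  then have den: "1 / 2 \<le> norm (1 - w ^ N)"
    using norm_triangle_ineq2[of 1 "w ^ N"] by simp
  have "norm (quot_poly N x w) \<le> (?S * norm w) / (1 / 2)"
    unfolding quot_poly_eq[OF assms(1) \<open>w \<noteq> 1\<close>] norm_divide
    using num den by (intro frac_le) (auto simp: sum_nonneg)
  then show ?thesis by (simp add: mult_ac)
qed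

text \<open>Since the norm of \<open>exp (a * z)\<close> is \<open>exp (a * Re z)\<close>, the
  hypothesis places this point outside the annulus between radii \<open>1 / 2\<close> and 2, where
  one of the two preceding bounds applies. This controls the vertical sides of the contour.\<close>

lemma norm_quot_poly_exp:
  assumes "x \<in> X_space N" "N > 0" "exp \<bar>a * Re z\<bar> \<ge> 2"
  shows "norm (quot_poly N x (exp (of_real a * z))) \<le> 2 * (\<Sum>j<N. norm (x j)) * exp (- \<bar>a * Re z\<bar>)"
proof (cases "a * Re z \<ge> 0")
  case True
  then show ?thesis
    using norm_quot_poly_large[of x N "exp (of_real a * z)"] assms by (simp add: exp_minus divide_inverse)
next
  case False
  then have "exp (a * Re z) \<le> 1 / 2"
    using assms(3) by (simp add: exp_minus field_simps)
  then show ?thesis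
    using norm_quot_poly_small[of x N "exp (of_real a * z)"] assms False by simp
qed

text \<open>For positive \<open>w\<close> the denominator is a sum of positive terms, so the bounds
  hold for all such \<open>w\<close>, including those near 1. The first and last partial sums of
  \<open>x\<close> vanish, so each remaining power \<open>w ^ j\<close> has both neighbours
  \<open>w ^ (j - 1)\<close> and \<open>w ^ (j + 1)\<close> among the terms of the
  denominator.\<close>

lemma norm_quot_poly_real:
  fixes w :: real
  assumes "x \<in> X_space N" "w > 0"
  defines "S \<equiv> \<Sum>j<N. norm (\<Sum>k\<le>j. x k)"
  shows "norm (quot_poly N x (of_real w)) \<le> S * w"
    and "norm (quot_poly N x (of_real w)) \<le> S / w"
proof -
  let ?D = "\<Sum>j<N. w ^ j" and ?q = "\<lambda>j. \<Sum>k\<le>j. x k"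
  have q0: "?q 0 = 0" using X_space_0[OF assms(1)] by simp
  have qN: "?q j = 0" if "Suc j = N" for j
    using X_space_sum[OF assms(1)] by (simp add: that flip: lessThan_Suc_atMost)
  have norm_le: "norm (quot_poly N x (of_real w)) \<le> S * c"
    if c: "c > 0" and le: "\<And>j. j < N \<Longrightarrow> ?q j \<noteq> 0 \<Longrightarrow> w ^ j \<le> ?D * c" for c
  proof (cases "N = 0")
    case False
    then have D: "?D > 0" using assms(2) by (intro sum_pos) auto
    have "norm (\<Sum>j<N. ?q j * complex_of_real w ^ j) \<le> (\<Sum>j<N. norm (?q j) * (?D * c))"
    proof (rule sum_norm_le)
      fix j assume "j \<in> {..<N}"
      then show "norm (?q j * complex_of_real w ^ j) \<le> norm (?q j) * (?D * c)"
        using le[of j] assms(2) by (cases "?q j = 0") (auto simp: norm_mult norm_power intro!: mult_left_mono)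
    qed
    also have "\<dots> = S * c * ?D"
      unfolding S_def sum_distrib_right[symmetric] by (simp only: mult_ac)
    finally have *: "norm (\<Sum>j<N. ?q j * complex_of_real w ^ j) \<le> S * c * ?D" .
    have "(\<Sum>j<N. complex_of_real w ^ j) = of_real ?D" by simp
    then have "norm (\<Sum>j<N. complex_of_real w ^ j) = ?D"
      using D by (metis abs_of_pos norm_of_real)
    then show ?thesis
      using * D by (simp add: quot_poly_def norm_divide pos_divide_le_eq)
  qed (simp add: quot_poly_def S_def)
  have mem: "w ^ i \<le> ?D" if "i < N" for i
    using that assms(2) by (intro member_le_sum) auto
  show "norm (quot_poly N x (of_real w)) \<le> S * w"
  proof (rule norm_le[OF assms(2)])
    fix j assume j: "j < N" "?q j \<noteq> 0"
    then obtain i where i: "j = Suc i" using q0 by (cases j) auto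
    show "w ^ j \<le> ?D * w" using mem[of i] j assms(2) by (simp add: i mult.commute)
  qed
  have "norm (quot_poly N x (of_real w)) \<le> S * (1 / w)"
  proof (rule norm_le)
    fix j assume j: "j < N" "?q j \<noteq> 0"
    \<comment> \<open>The index \<open>N - 1\<close> is excluded because its partial sum is the
      whole sum of the entries.\<close>
    then have "Suc j < N" using qN[of j] by (cases "Suc j = N") auto
    from mem[OF this] show "w ^ j \<le> ?D * (1 / w)" using assms(2) by (simp add: field_simps)
  qed (use assms in simp)
  then show "norm (quot_poly N x (of_real w)) \<le> S / w" by simp
qed

lemma norm_quot_poly_real_exp:
  assumes "x \<in> X_space N" "a \<ge> 0"
  shows "norm (quot_poly N x (of_real (exp (a * t)))) \<le> (\<Sum>j<N. norm (\<Sum>k\<le>j. x k)) * exp (- (a * \<bar>t\<bar>))"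
  using norm_quot_poly_real[OF assms(1), of "exp (a * t)"] assms(2)
  by (cases "t \<ge> 0") (auto simp: exp_minus divide_inverse)

lemma continuous_on_quot_poly_real:
  assumes "N > 0"
  shows "continuous_on UNIV (\<lambda>t. quot_poly N x (of_real (exp (a * t))))"
proof -
  have "(\<Sum>j<N. complex_of_real (exp (a * t)) ^ j) \<noteq> 0" for t
  proof -
    have "0 < (\<Sum>j<N. exp (a * t) ^ j)" using assms by (intro sum_pos) auto
    then have "complex_of_real (\<Sum>j<N. exp (a * t) ^ j) \<noteq> 0" by (metis less_irrefl of_real_eq_0_iff)
    then show ?thesis by simp
  qed
  then show ?thesis
    unfolding quot_poly_def by (intro continuous_intros) auto
qed

section \<open>Continuity and integrability of \<open>Phi\<close>\<close>

lemma Phi_quot_eq: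
  assumes "x \<in> X_space N" "N > 0"
  shows "Phi_quot N x t = (\<Sum>k<N. x k * complex_of_real (exp (2 * pi / sqrt N * t)) ^ k)
      / (1 - complex_of_real (exp (2 * pi / sqrt N * t)) ^ N)"
proof -
  have "exp (2 * pi * real k * t / sqrt N) = exp (2 * pi / sqrt N * t) ^ k" for k
    by (simp add: exp_of_nat_mult[symmetric] mult_ac)
  moreover have "exp (2 * pi * t * sqrt N) = exp (2 * pi / sqrt N * t) ^ N"
    using assms(2) by (simp add: exp_of_nat_mult[symmetric] field_simps)
  moreover have "{..<N} = insert 0 {1..N-1}" using assms(2) by auto
  ultimately show ?thesis
    using X_space_0[OF assms(1)] by (simp add: Phi_quot_def del: exp_gt_zero)
qed

text \<open>Away from 0 this is the substitution \<open>w = exp (2 pi t / sqrt N)\<close>. The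
  right-hand side is continuous at 0, so its value there is the limit by which \<open>Phi\<close> is
  defined.\<close>

lemma Phi_eq_quot_poly:
  assumes "x \<in> X_space N" "N > 0"
  shows "Phi N x t = quot_poly N x (of_real (exp (2 * pi / sqrt N * t)))"
proof -
  define f where "f t = quot_poly N x (of_real (exp (2 * pi / sqrt N * t)))" for t :: real
  have quot: "Phi_quot N x t = f t" if "t \<noteq> 0" for t
  proof -
    have "complex_of_real (exp (2 * pi / sqrt N * t)) \<noteq> 1"
      using that assms(2) by (simp only: of_real_eq_1_iff) simp
    then show ?thesis
      unfolding f_def by (subst Phi_quot_eq[OF assms]) (simp add: quot_poly_eq[OF assms(1)])
  qed
  have "isCont f 0"
    using continuous_on_quot_poly_real[OF assms(2), of x "2 * pi / sqrt N"]
    unfolding f_def continuous_on_eq_continuous_at[OF open_UNIV] by blast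
  then have "(f \<longlongrightarrow> f 0) (at 0)" by (simp add: isCont_def)
  then have "(Phi_quot N x \<longlongrightarrow> f 0) (at 0)"
    by (rule Lim_transform_eventually) (auto simp: eventually_at_filter quot)
  then have "Lim (at 0) (Phi_quot N x) = f 0"
    by (intro tendsto_Lim) auto
  then show ?thesis using quot[of t] by (auto simp: Phi_def f_def)
qed

lemma continuous_on_Phi:
  assumes "x \<in> X_space N" "N > 0"
  shows "continuous_on UNIV (Phi N x)"
proof -
  have "Phi N x = (\<lambda>t. quot_poly N x (of_real (exp (2 * pi / sqrt N * t))))"
    by (rule ext) (rule Phi_eq_quot_poly[OF assms])
  then show ?thesis
    using continuous_on_quot_poly_real[OF assms(2)] by (simp only:)
qed

lemma integrable_exp_minus_abs:
  fixes a :: real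
  assumes "a > 0"
  shows "integrable lborel (\<lambda>t. exp (- (a * \<bar>t\<bar>)))"
proof -
  have "(\<lambda>t. exp (- a * t)) integrable_on {0..}"
    using assms by (rule integrable_on_exp_minus_to_infinity)
  then have "(\<lambda>t. exp (- a * t)) absolutely_integrable_on {0..}"
    by (intro nonnegative_absolutely_integrable_1) auto
  then have pos: "set_integrable lborel {0..} (\<lambda>t. exp (- a * t))"
    unfolding set_integrable_def by (subst (asm) integrable_completion) auto
  \<comment> \<open>The negative half-line follows by the reflection
    \<open>t \<mapsto> - t\<close>.\<close>
  then have "set_integrable lborel {..0} (\<lambda>t. exp (a * t))"
    unfolding set_integrable_def
    by (subst (asm) lborel_integrable_real_affine_iff[symmetric, of "-1" _ 0]) (auto simp: indicator_def)
  \<comment> \<open>This sum takes the value 2 at 0, where the half-lines overlap, so it serves as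
    an upper bound.\<close>
  then have "integrable lborel (\<lambda>t. indicator {0..} t *\<^sub>R exp (- a * t) + indicator {..0} t *\<^sub>R exp (a * t))"
    using pos unfolding set_integrable_def by (rule Bochner_Integration.integrable_add[rotated])
  then show ?thesis
    by (rule Bochner_Integration.integrable_bound) (auto simp: indicator_def)
qed

lemma integrable_Phi:
  assumes "x \<in> X_space N" "N > 0"
  shows "integrable lborel (Phi N x)"
proof (rule Bochner_Integration.integrable_bound)
  let ?S = "\<Sum>j<N. norm (\<Sum>k\<le>j. x k)"
  show "integrable lborel (\<lambda>t. ?S * exp (- (2 * pi / sqrt N * \<bar>t\<bar>)))"
    using assms(2) by (intro integrable_mult_right integrable_exp_minus_abs) auto
  show "Phi N x \<in> borel_measurable lborel"
    using continuous_on_Phi[OF assms] by (simp add: borel_measurable_continuous_onI)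
  have "norm (Phi N x t) \<le> norm (?S * exp (- (2 * pi / sqrt N * \<bar>t\<bar>)))" for t
    using norm_quot_poly_real_exp[OF assms(1), of "2 * pi / sqrt N" t]
    unfolding Phi_eq_quot_poly[OF assms] by (simp add: abs_mult sum_nonneg)
  then show "AE t in lborel. norm (Phi N x t) \<le> norm (?S * exp (- (2 * pi / sqrt N * \<bar>t\<bar>)))"
    by simp
qed

subsection \<open>Residues in the strip\<close>

text \<open>The integrand of the Fourier integral of \<open>Phi N x\<close>, continued from real
  \<open>t\<close> to complex \<open>z\<close>.\<close>

definition strip_fun :: "nat \<Rightarrow> (nat \<Rightarrow> complex) \<Rightarrow> real \<Rightarrow> complex \<Rightarrow> complex" where
  "strip_fun N x \<xi> z = quot_poly N x (exp (of_real (2 * pi / sqrt N) * z))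
     * exp (- (2 * complex_of_real pi * \<i> * of_real \<xi> * z))"

definition strip_pole :: "nat \<Rightarrow> nat \<Rightarrow> complex" where
  "strip_pole N m = \<i> * of_real (real m / sqrt N)"

text \<open>
  The strip contains the rectangle with $0 \le \mathrm{Im}\, z \le \sqrt N$ and stops short of the next poles
  above and below.
\<close>

definition strip :: "nat \<Rightarrow> complex set" where
  "strip N = {z. - (1 / sqrt N) < Im z} \<inter> {z. Im z < sqrt N + 1 / sqrt N}"

lemma open_strip: "open (strip N)" and convex_strip: "convex (strip N)"
  unfolding strip_def
  by (intro open_Int open_halfspace_Im_gt open_halfspace_Im_lt)
     (intro convex_Int convex_halfspace_Im_gt convex_halfspace_Im_lt)

lemma exp_scaled_power:
  fixes z :: complex
  assumes "N > 0"
  shows "exp (of_real (2 * pi / sqrt N) * z) ^ N = exp (of_real (2 * pi * sqrt N) * z)"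
proof -
  have "of_nat N * complex_of_real (2 * pi / sqrt N) = complex_of_real (real N * (2 * pi / sqrt N))"
    by simp
  also have "real N * (2 * pi / sqrt N) = 2 * pi * sqrt N"
    using assms by (simp add: field_simps)
  finally show ?thesis by (simp only: exp_of_nat_mult[symmetric] mult.assoc[symmetric])
qed

text \<open>A zero of the geometric sum makes the exponential an \<open>N\<close>-th root of unity
  other than 1. Hence \<open>z = i n / sqrt N\<close> with \<open>n\<close> an integer; the strip
  confines \<open>n\<close> to \<open>0..N\<close>, and both end values would give the root
  1.\<close>

lemma strip_zeros:
  assumes "N > 0" "z \<in> strip N" and zero: "(\<Sum>j<N. exp (of_real (2 * pi / sqrt N) * z) ^ j) = 0"
  shows "z \<in> strip_pole N ` {1..<N}"
proof -
  let ?s = "sqrt N" and ?w = "exp (of_real (2 * pi / sqrt N) * z)"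
  have s: "?s > 0" "?s * ?s = real N" using assms(1) by auto
  have w1: "?w \<noteq> 1"
  proof
    assume "?w = 1"
    with zero assms(1) show False by simp
  qed
  have "?w ^ N = 1" using one_diff_power_eq[of ?w N] zero by simp
  then have "exp (of_real (2 * pi * ?s) * z) = 1"
    using exp_scaled_power[OF assms(1)] by simp
  then obtain n :: int where Re: "2 * pi * ?s * Re z = 0" and Im: "2 * pi * ?s * Im z = of_int (2 * n) * pi"
    unfolding exp_eq_1 by auto
  from Re s have Re0: "Re z = 0" by simp
  from Im s have "Im z = of_int n / ?s" by (simp add: field_simps)
  with Re0 have z: "z = \<i> * of_real (of_int n / ?s)" by (simp add: complex_eq_iff)
  have "- 1 < real_of_int n" "real_of_int n < real N + 1"
    using assms(2) s \<open>Im z = _\<close> by (auto simp: strip_def field_simps)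
  then have "0 \<le> n" "n \<le> int N" by linarith+
  moreover have "n \<noteq> 0" using w1 by (auto simp: z)
  moreover have "n \<noteq> int N"
  proof
    assume "n = int N"
    then have "z = \<i> * of_real ?s" using s by (simp add: z field_simps flip: of_real_mult)
    then have "of_real (2 * pi / ?s) * z = 2 * of_real pi * \<i>" using s by simp
    then have "?w = 1" by (simp only: exp_two_pi_i)
    with w1 show False by simp
  qed
  ultimately have "n = int (nat n)" "nat n \<in> {1..<N}" by auto
  then show ?thesis
    by (intro image_eqI[of _ _ "nat n"]) (auto simp: z strip_pole_def)
qed

lemma holomorphic_strip_fun:
  assumes "N > 0"
  shows "strip_fun N x \<xi> holomorphic_on strip N - strip_pole N ` {1..<N}"
  unfolding strip_fun_def quot_poly_def
  by (intro holomorphic_intros) (use strip_zeros[OF assms] in auto)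

lemma strip_pole_in_strip: "N > 0 \<Longrightarrow> m \<in> {1..<N} \<Longrightarrow> strip_pole N m \<in> strip N"
  by (auto simp: strip_pole_def strip_def field_simps)

lemma exp_strip_pole:
  assumes "N > 0"
  shows "exp (of_real (2 * pi / sqrt N) * strip_pole N m) = exp (2 * complex_of_real pi * \<i> * of_nat m / of_nat N)"
proof -
  have "2 * pi / sqrt N * (m / sqrt N) = 2 * pi * m / N"
    by simp
  then have "of_real (2 * pi / sqrt N) * strip_pole N m = \<i> * of_real (2 * pi * m / N)"
    by (simp only: strip_pole_def mult.left_commute[of _ \<i>] of_real_mult[symmetric])
  also have "\<dots> = 2 * complex_of_real pi * \<i> * of_nat m / of_nat N"
    by simp
  finally show ?thesis by (simp only:)
qed

lemma exp_strip_pole_neq_1: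
  assumes "m \<in> {1..<N}"
  shows "exp (of_real (2 * pi / sqrt N) * strip_pole N m) \<noteq> 1"
  using assms complex_root_unity_eq[of N m 0] exp_strip_pole[of N m] by auto

text \<open>The denominator \<open>1 - exp (c z)\<close> with \<open>c = 2 pi sqrt N\<close> has
  derivative \<open>- c\<close> at the pole, so the residue is the remaining factor there divided by
  \<open>- c\<close>. The result also covers a vanishing factor, where the residue is 0.\<close>

lemma residue_strip_fun:
  assumes "x \<in> X_space N" "m \<in> {1..<N}"
  shows "residue (strip_fun N x \<xi>) (strip_pole N m)
    = - (1 / (2 * complex_of_real pi * of_real (sqrt N))) *
      ((\<Sum>k<N. x k * exp (2 * complex_of_real pi * \<i> * of_nat m * of_nat k / of_nat N))
        * of_real (exp (2 * pi * \<xi> * m / sqrt N)))"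
proof (rule residue_simple')
  let ?p = "strip_pole N m" and ?w = "\<lambda>z. exp (of_real (2 * pi / sqrt N) * z)"
  let ?c = "complex_of_real (2 * pi * sqrt N)"
  have N: "N > 0" using assms(2) by auto
  \<comment> \<open>Removing the other poles leaves an open set in which \<open>?p\<close> is the
    only possible singularity.\<close>
  let ?S = "strip N - strip_pole N ` ({1..<N} - {m})"
  show "open ?S" by (intro open_Diff open_strip finite_imp_closed) auto
  have inj: "strip_pole N i = strip_pole N j \<longleftrightarrow> i = j" for i j
    using N by (simp add: strip_pole_def)
  show "?p \<in> ?S" using strip_pole_in_strip[OF N assms(2)] by (auto simp: inj)
  have "?S - {?p} = strip N - strip_pole N ` {1..<N}" using assms(2) by auto
  then show "strip_fun N x \<xi> holomorphic_on ?S - {?p}"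
    using holomorphic_strip_fun[OF N] by simp
  have wp: "?w ?p ^ N = 1"
    unfolding exp_strip_pole[OF N] using N exp_2pi_i_of_nat[of m]
    by (simp add: exp_of_nat_mult[symmetric])
  have cp: "exp (?c * ?p) = 1" using wp exp_scaled_power[OF N, of ?p] by simp
  have c0: "?c \<noteq> 0" using N by simp
  have "((\<lambda>z. 1 - exp (?c * z)) has_field_derivative - ?c) (at ?p)"
    by (rule derivative_eq_intros refl)+ (use cp in simp)
  then have "((\<lambda>z. (1 - exp (?c * z)) / (z - ?p)) \<longlongrightarrow> - ?c) (at ?p)"
    using cp by (simp add: has_field_derivative_iff)
  then have lim1: "((\<lambda>z. inverse ((1 - exp (?c * z)) / (z - ?p))) \<longlongrightarrow> inverse (- ?c)) (at ?p)"
    using c0 by (intro tendsto_inverse) auto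
  let ?F = "\<lambda>z. (\<Sum>k<N. x k * ?w z ^ k) * exp (- (2 * complex_of_real pi * \<i> * of_real \<xi> * z))"
  have lim2: "(?F \<longlongrightarrow> ?F ?p) (at ?p)" by (intro tendsto_intros)
  \<comment> \<open>The form with denominator \<open>1 - w ^ N\<close> is available only for
    \<open>w \<noteq> 1\<close>, which holds near the pole.\<close>
  have "(?w \<longlongrightarrow> ?w ?p) (at ?p)" by (intro tendsto_intros)
  then have "eventually (\<lambda>z. ?w z \<noteq> 1) (at ?p)"
    using exp_strip_pole_neq_1[OF assms(2)] by (rule tendsto_imp_eventually_ne)
  then have ev: "eventually (\<lambda>z. inverse ((1 - exp (?c * z)) / (z - ?p)) * ?F z = strip_fun N x \<xi> z * (z - ?p)) (at ?p)"
  proof eventually_elim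
    case (elim z)
    show ?case
      unfolding strip_fun_def quot_poly_eq[OF assms(1) elim] exp_scaled_power[OF N]
      by (simp add: divide_inverse)
  qed
  have lim: "((\<lambda>z. strip_fun N x \<xi> z * (z - ?p)) \<longlongrightarrow> inverse (- ?c) * ?F ?p) (at ?p)"
    by (rule Lim_transform_eventually[OF tendsto_mult[OF lim1 lim2] ev])
  have wk: "?w ?p ^ k = exp (2 * complex_of_real pi * \<i> * of_nat m * of_nat k / of_nat N)" for k
    unfolding exp_strip_pole[OF N] by (simp add: exp_of_nat_mult[symmetric] mult_ac)
  have "- (2 * complex_of_real pi * \<i> * of_real \<xi> * ?p) = of_real (2 * pi * \<xi> * m / sqrt N)"
    by (simp add: strip_pole_def algebra_simps)
  then have e: "exp (- (2 * complex_of_real pi * \<i> * of_real \<xi> * ?p)) = of_real (exp (2 * pi * \<xi> * m / sqrt N))"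
    by (simp only: exp_of_real)
  have inv: "inverse (- ?c) = - (1 / (2 * complex_of_real pi * of_real (sqrt N)))"
    by (simp add: inverse_eq_divide)
  show "((\<lambda>z. strip_fun N x \<xi> z * (z - ?p)) \<longlongrightarrow> - (1 / (2 * complex_of_real pi * of_real (sqrt N))) *
      ((\<Sum>k<N. x k * exp (2 * complex_of_real pi * \<i> * of_nat m * of_nat k / of_nat N))
        * of_real (exp (2 * pi * \<xi> * m / sqrt N)))) (at ?p)"
    using lim by (simp only: wk e inv)
qed

lemma contour_integral_rectpath_strip_fun:
  assumes "x \<in> X_space N" "N > 0" "R > 0"
  shows "contour_integral (rectpath (of_real (- R)) (Complex R (sqrt N))) (strip_fun N x \<xi>)
    = - \<i> * (\<Sum>m=1..N-1. dft N (reflect N x) m * of_real (exp (2 * pi * m * \<xi> / sqrt N)))"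
proof -
  let ?s = "sqrt N" and ?r = "rectpath (of_real (- R)) (Complex R (sqrt N))"
  let ?P = "strip_pole N ` {1..<N}"
  have s: "?s > 0" using assms(2) by simp
  have sub: "cbox (of_real (- R)) (Complex R ?s) \<subseteq> strip N"
    using s by (auto simp: in_cbox_complex_iff strip_def intro: less_le_trans[of _ 0] le_less_trans[of _ ?s])
  have inbox: "strip_pole N m \<in> box (of_real (- R)) (Complex R ?s)" if "m \<in> {1..<N}" for m
    using that assms(2,3) by (auto simp: in_box_complex_iff strip_pole_def field_simps)
  have "contour_integral ?r (strip_fun N x \<xi>)
      = 2 * pi * \<i> * (\<Sum>p\<in>?P. winding_number ?r p * residue (strip_fun N x \<xi>) p)"
  proof (rule Residue_theorem)
    show "open (strip N)" "connected (strip N)"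
      by (simp_all add: open_strip convex_strip convex_connected)
    show "strip_fun N x \<xi> holomorphic_on strip N - ?P"
      by (rule holomorphic_strip_fun[OF assms(2)])
    \<comment> \<open>All poles lie in the open box. The horizontal edges meet 0 and
      \<open>i sqrt N\<close>, where \<open>strip_fun\<close> is holomorphic thanks to the cancelled
      factor.\<close>
    have "path_image ?r = cbox (of_real (- R)) (Complex R ?s) - box (of_real (- R)) (Complex R ?s)"
      using s assms(3) by (intro path_image_rectpath_cbox_minus_box) auto
    then show "path_image ?r \<subseteq> strip N - ?P"
      using sub inbox by blast
    show "\<forall>z. z \<notin> strip N \<longrightarrow> winding_number ?r z = 0"
      using sub s assms(3) by (intro allI impI winding_number_rectpath_outside) auto
  qed auto
  also have "(\<Sum>p\<in>?P. winding_number ?r p * residue (strip_fun N x \<xi>) p)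
      = (\<Sum>p\<in>?P. residue (strip_fun N x \<xi>) p)"
    by (intro sum.cong refl) (use inbox winding_number_rectpath in auto)
  also have "\<dots> = (\<Sum>m\<in>{1..<N}. residue (strip_fun N x \<xi>) (strip_pole N m))"
    using assms(2) by (intro sum.reindex_cong[of "strip_pole N"]) (auto simp: inj_on_def strip_pole_def)
  \<comment> \<open>The factor \<open>1 / sqrt N\<close> of each residue becomes the normalization
    of \<open>dft\<close>.\<close>
  also have "\<dots> = (\<Sum>m\<in>{1..<N}. - (1 / (2 * complex_of_real pi)) *
      (dft N (reflect N x) m * of_real (exp (2 * pi * m * \<xi> / ?s))))"
    by (intro sum.cong refl)
       (simp add: residue_strip_fun[OF assms(1)] dft_reflect mult_ac)
  also have "{1..<N} = {1..N-1}" using assms(2) by auto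
  finally show ?thesis
    by (subst (asm) sum_distrib_left[symmetric]) simp
qed

subsection \<open>The Fourier transform as a contour integral\<close>

lemma contour_integral_rectpath:
  assumes "continuous_on (path_image (rectpath a b)) f"
  defines "c \<equiv> Complex (Re b) (Im a)" and "d \<equiv> Complex (Re a) (Im b)"
  shows "contour_integral (rectpath a b) f = contour_integral (linepath a c) f
    + contour_integral (linepath c b) f + contour_integral (linepath b d) f + contour_integral (linepath d a) f"
proof -
  have "path_image (rectpath a b) = closed_segment a c \<union> closed_segment c b \<union> closed_segment b d \<union> closed_segment d a"
    by (simp add: rectpath_def Let_def path_image_join c_def d_def Un_assoc)
  then have "f contour_integrable_on linepath a c" "f contour_integrable_on linepath c b"
    "f contour_integrable_on linepath b d" "f contour_integrable_on linepath d a"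
    using assms(1) by (auto intro!: contour_integrable_continuous_linepath elim: continuous_on_subset)
  then show ?thesis
    by (simp add: rectpath_def Let_def c_def[symmetric] d_def[symmetric])
qed

text \<open>The shift \<open>i sqrt N\<close> is a period of \<open>exp (2 pi z / sqrt N)\<close>,
  so only the Fourier kernel contributes a factor. This relates the two horizontal edges of the
  contour.\<close>

lemma strip_fun_add_period:
  assumes "N > 0"
  shows "strip_fun N x \<xi> (z + \<i> * of_real (sqrt N)) = of_real (exp (2 * pi * \<xi> * sqrt N)) * strip_fun N x \<xi> z"
proof -
  have "of_real (2 * pi / sqrt N) * (z + \<i> * of_real (sqrt N)) = of_real (2 * pi / sqrt N) * z + 2 * of_real pi * \<i>"
    using assms by (simp add: distrib_left)
  then have "exp (of_real (2 * pi / sqrt N) * (z + \<i> * of_real (sqrt N))) = exp (of_real (2 * pi / sqrt N) * z)"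
    by (simp only: exp_add exp_two_pi_i mult_1_right)
  moreover have "- (2 * complex_of_real pi * \<i> * of_real \<xi> * (z + \<i> * of_real (sqrt N)))
      = of_real (2 * pi * \<xi> * sqrt N) + - (2 * complex_of_real pi * \<i> * of_real \<xi> * z)"
    by (simp add: algebra_simps)
  then have "exp (- (2 * complex_of_real pi * \<i> * of_real \<xi> * (z + \<i> * of_real (sqrt N))))
      = of_real (exp (2 * pi * \<xi> * sqrt N)) * exp (- (2 * complex_of_real pi * \<i> * of_real \<xi> * z))"
    by (simp only: exp_add exp_of_real)
  ultimately show ?thesis
    unfolding strip_fun_def by (simp only: mult_ac)
qed

lemma strip_fun_of_real:
  assumes "x \<in> X_space N" "N > 0"
  shows "strip_fun N x \<xi> (of_real t) = Phi N x t * exp (- (2 * complex_of_real pi * \<i> * of_real \<xi> * of_real t))"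
  unfolding strip_fun_def Phi_eq_quot_poly[OF assms] of_real_mult[symmetric] exp_of_real ..

text \<open>The kernel has norm \<open>exp (2 pi \<xi> Im z)\<close>, which is bounded for these
  heights; the decay comes from \<open>quot_poly\<close>.\<close>

lemma norm_strip_fun_le:
  assumes "x \<in> X_space N" "N > 0" "exp (2 * pi / sqrt N * \<bar>Re z\<bar>) \<ge> 2" "0 \<le> Im z" "Im z \<le> sqrt N"
  shows "norm (strip_fun N x \<xi> z)
    \<le> 2 * (\<Sum>j<N. norm (x j)) * exp (2 * pi * \<bar>\<xi>\<bar> * sqrt N) * exp (- (2 * pi / sqrt N * \<bar>Re z\<bar>))"
proof -
  let ?a = "2 * pi / sqrt N"
  have a: "\<bar>?a * Re z\<bar> = ?a * \<bar>Re z\<bar>" by (simp add: abs_mult)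
  have "\<xi> * Im z \<le> \<bar>\<xi>\<bar> * sqrt N"
    using assms(4,5) by (intro mult_mono) auto
  then have "2 * pi * (\<xi> * Im z) \<le> 2 * pi * (\<bar>\<xi>\<bar> * sqrt N)"
    by (intro mult_left_mono) auto
  then have "norm (exp (- (2 * complex_of_real pi * \<i> * of_real \<xi> * z))) \<le> exp (2 * pi * \<bar>\<xi>\<bar> * sqrt N)"
    by (simp add: mult_ac)
  moreover have "norm (quot_poly N x (exp (of_real ?a * z))) \<le> 2 * (\<Sum>j<N. norm (x j)) * exp (- (?a * \<bar>Re z\<bar>))"
    using norm_quot_poly_exp[OF assms(1,2), of ?a z] assms(3) unfolding a by simp
  ultimately have "norm (strip_fun N x \<xi> z)
      \<le> (2 * (\<Sum>j<N. norm (x j)) * exp (- (?a * \<bar>Re z\<bar>))) * exp (2 * pi * \<bar>\<xi>\<bar> * sqrt N)"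
    unfolding strip_fun_def norm_mult by (intro mult_mono) (auto simp: sum_nonneg)
  then show ?thesis by (simp only: mult_ac)
qed

section \<open>Limits of integrals and continuity of the Fourier transform\<close>

text \<open>Dominated convergence by \<open>norm (h t)\<close>. It passes from the gauge integrals
  over bounded intervals, which come from contour integrals, to the Lebesgue integral in
  \<open>fourier\<close>.\<close>

lemma tendsto_integral_symmetric_interval:
  fixes h :: "real \<Rightarrow> 'a::euclidean_space"
  assumes "integrable lborel h"
  shows "(\<lambda>n. integral {- real n..real n} h) \<longlonglongrightarrow> integral\<^sup>L lborel h"
proof -
  have "(\<lambda>n. \<integral>t. indicator {- real n..real n} t *\<^sub>R h t \<partial>lborel) \<longlonglongrightarrow> integral\<^sup>L lborel h"
  proof (rule integral_dominated_convergence[where w = "\<lambda>t. norm (h t)"])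
    have "(\<lambda>n. indicator {- real n..real n} t *\<^sub>R h t) \<longlonglongrightarrow> h t" for t
    proof (rule tendsto_eventually)
      obtain n0 where "\<bar>t\<bar> \<le> real n0" using real_arch_simple by blast
      then show "\<forall>\<^sub>F n in sequentially. indicator {- real n..real n} t *\<^sub>R h t = h t"
        by (intro eventually_sequentiallyI[of n0]) (auto simp: indicator_def)
    qed
    then show "AE t in lborel. (\<lambda>n. indicator {- real n..real n} t *\<^sub>R h t) \<longlonglongrightarrow> h t" by simp
  qed (use assms in \<open>auto simp: indicator_def\<close>)
  moreover have "set_integrable lborel {- real n..real n} h" for n
    using assms unfolding set_integrable_def by (intro integrable_mult_indicator) auto
  then have "integral {- real n..real n} h = (\<integral>t. indicator {- real n..real n} t *\<^sub>R h t \<partial>lborel)" for n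
    using set_borel_integral_eq_integral(2)[of "{- real n..real n}" h] by (simp add: set_lebesgue_integral_def)
  ultimately show ?thesis by simp
qed

lemma integrable_mult_exp_imaginary:
  assumes "integrable lborel f"
  shows "integrable lborel (\<lambda>t. f t * exp (- (2 * complex_of_real pi * \<i> * of_real \<xi> * of_real t)))"
proof (rule Bochner_Integration.integrable_bound[OF assms])
  show "(\<lambda>t. f t * exp (- (2 * complex_of_real pi * \<i> * of_real \<xi> * of_real t))) \<in> borel_measurable lborel"
  proof (rule borel_measurable_times)
    show "f \<in> borel_measurable lborel" using assms by (rule borel_measurable_integrable)
    have "continuous_on UNIV (\<lambda>t. exp (- (2 * complex_of_real pi * \<i> * of_real \<xi> * of_real t)))"
      by (intro continuous_intros)
    then show "(\<lambda>t. exp (- (2 * complex_of_real pi * \<i> * of_real \<xi> * of_real t))) \<in> borel_measurable lborel"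
      by (simp add: borel_measurable_continuous_onI)
  qed
qed (simp add: norm_mult)

text \<open>The kernel has norm 1 and is continuous in \<open>\<xi>\<close>, so
  \<open>norm (f t)\<close> dominates uniformly in \<open>\<xi>\<close>.\<close>

lemma isCont_fourier:
  assumes "integrable lborel f"
  shows "isCont (fourier f) \<xi>"
  unfolding isCont_def tendsto_at_iff_sequentially
proof (intro allI impI)
  fix X :: "nat \<Rightarrow> real" assume X: "X \<longlonglongrightarrow> \<xi>"
  let ?h = "\<lambda>\<xi> t. f t * exp (- (2 * complex_of_real pi * \<i> * of_real \<xi> * of_real t))"
  have "(\<lambda>n. integral\<^sup>L lborel (?h (X n))) \<longlonglongrightarrow> integral\<^sup>L lborel (?h \<xi>)"
  proof (rule integral_dominated_convergence[where w = "\<lambda>t. norm (f t)"])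
    show "AE t in lborel. (\<lambda>n. ?h (X n) t) \<longlonglongrightarrow> ?h \<xi> t"
      by (intro AE_I2 tendsto_intros X)
  qed (use assms integrable_mult_exp_imaginary[OF assms] in \<open>auto simp: norm_mult\<close>)
  then show "(fourier f \<circ> X) \<longlonglongrightarrow> fourier f \<xi>"
    by (simp add: fourier_def comp_def)
qed

text \<open>The bottom edge contributes the integral of \<open>h\<close> and the top edge
  \<open>- ?E\<close> times it, while the vertical sides vanish in the limit. The product form
  avoids dividing by \<open>1 - ?E\<close>, which is 0 at \<open>\<xi> = 0\<close>.\<close>

lemma fourier_Phi_times:
  assumes "x \<in> X_space N" "N > 0"
  shows "(1 - of_real (exp (2 * pi * \<xi> * sqrt N))) * fourier (Phi N x) \<xi>
    = - \<i> * (\<Sum>m=1..N-1. dft N (reflect N x) m * of_real (exp (2 * pi * m * \<xi> / sqrt N)))"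
    (is "(1 - ?E) * _ = ?C")
proof -
  let ?s = "sqrt N" and ?f = "strip_fun N x \<xi>" and ?a = "2 * pi / sqrt N"
  define h where "h t = ?f (of_real t)" for t :: real
  define side where "side r = contour_integral (linepath (Complex r 0) (Complex r ?s)) ?f" for r
  define K where "K = 2 * (\<Sum>j<N. norm (x j)) * exp (2 * pi * \<bar>\<xi>\<bar> * ?s)"
  have s: "?s > 0" using assms(2) by simp
  have a: "?a > 0" using s by simp
  have contf: "continuous_on (strip N - strip_pole N ` {1..<N}) ?f"
    by (rule holomorphic_on_imp_continuous_on[OF holomorphic_strip_fun[OF assms(2)]])
  have h_eq: "h t = Phi N x t * exp (- (2 * complex_of_real pi * \<i> * of_real \<xi> * of_real t))" for t
    unfolding h_def by (rule strip_fun_of_real[OF assms])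
  have h_int: "integrable lborel h"
    unfolding h_eq[abs_def] by (intro integrable_mult_exp_imaginary integrable_Phi assms)
  have fourier_h: "fourier (Phi N x) \<xi> = integral\<^sup>L lborel h"
    unfolding fourier_def h_eq[abs_def] ..
  \<comment> \<open>The poles have real part 0 and height strictly between 0 and \<open>?s\<close>;
    horizontal edges and points off the imaginary axis therefore avoid them.\<close>
  have in_strip: "z \<in> strip N - strip_pole N ` {1..<N}" if "0 \<le> Im z" "Im z \<le> ?s" "Im z \<in> {0, ?s} \<or> Re z \<noteq> 0" for z
  proof -
    have "z \<in> strip N"
      using that s by (auto simp: strip_def intro: less_le_trans[of _ 0] le_less_trans[of _ ?s])
    moreover have "z \<noteq> strip_pole N m" if m: "m \<in> {1..<N}" for m
    proof -
      have "0 < real m / ?s" "real m / ?s < ?s" using m s by (auto simp: field_simps)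
      then show ?thesis
        using \<open>Im z \<in> {0, ?s} \<or> Re z \<noteq> 0\<close> by (auto simp: strip_pole_def)
    qed
    ultimately show ?thesis by blast
  qed
  have rect: "(1 - ?E) * integral {- R..R} h + (side R - side (- R)) = ?C" if R: "R > 0" for R
  proof -
    let ?r = "rectpath (of_real (- R)) (Complex R ?s)"
    have "path_image ?r \<subseteq> strip N - strip_pole N ` {1..<N}"
      using R s by (intro subsetI in_strip) (auto simp: path_image_rectpath)
    then have contr: "continuous_on (path_image ?r) ?f"
      by (rule continuous_on_subset[OF contf])
    have "contour_integral ?r ?f = contour_integral (linepath (of_real (- R)) (of_real R)) ?f + side R
        + contour_integral (linepath (Complex R ?s) (Complex (- R) ?s)) ?f
        + contour_integral (linepath (Complex (- R) ?s) (Complex (- R) 0)) ?f"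
      using contour_integral_rectpath[OF contr] by (simp add: side_def complex_of_real_def)
    also have "contour_integral (linepath (Complex (- R) ?s) (Complex (- R) 0)) ?f = - side (- R)"
    proof -
      have "continuous_on (closed_segment (Complex (- R) 0) (Complex (- R) ?s)) ?f"
        using R s by (intro continuous_on_subset[OF contf] subsetI in_strip) (auto simp: closed_segment_same_Re closed_segment_eq_real_ivl)
      then show ?thesis
        unfolding side_def by (metis contour_integral_reverse_linepath minus_minus)
    qed
    also have "contour_integral (linepath (Complex R ?s) (Complex (- R) ?s)) ?f
        = ?E * contour_integral (linepath (of_real R) (of_real (- R))) ?f"
    proof -
      \<comment> \<open>The top edge is the bottom edge traversed backwards and shifted by
        \<open>i ?s\<close>.\<close>
      have "linepath (Complex R ?s) (Complex (- R) ?s) t = linepath (of_real R) (of_real (- R)) t + \<i> * of_real ?s" for t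
        by (simp add: linepath_def complex_eq_iff algebra_simps)
      moreover have "Complex (- R) ?s - Complex R ?s = of_real (- R) - of_real R"
        by (simp add: complex_eq_iff)
      ultimately show ?thesis
        by (simp only: contour_integral_integral vector_derivative_linepath_at
            strip_fun_add_period[OF assms(2)] mult.assoc integral_mult_right)
    qed
    also have "contour_integral (linepath (of_real R) (of_real (- R))) ?f
        = - contour_integral (linepath (of_real (- R)) (of_real R)) ?f"
    proof (rule contour_integral_reverse_linepath)
      show "continuous_on (closed_segment (of_real R) (of_real (- R))) ?f"
        using s by (intro continuous_on_subset[OF contf] subsetI in_strip) (auto simp: closed_segment_same_Im)
    qed
    also have "contour_integral (linepath (of_real (- R)) (of_real R)) ?f = integral {- R..R} h"
      using R by (subst contour_integral_linepath_Reals_eq) (auto simp: h_def[abs_def])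
    finally show ?thesis
      using contour_integral_rectpath_strip_fun[OF assms R, of \<xi>] by (simp add: algebra_simps)
  qed
  have side_bound: "norm (side r) \<le> K * exp (- (?a * \<bar>r\<bar>)) * ?s" if r: "r \<noteq> 0" "exp (?a * \<bar>r\<bar>) \<ge> 2" for r
  proof -
    have seg: "Re z = r \<and> 0 \<le> Im z \<and> Im z \<le> ?s" if "z \<in> closed_segment (Complex r 0) (Complex r ?s)" for z
      using that s by (auto simp: closed_segment_same_Re closed_segment_eq_real_ivl)
    have "norm (side r) \<le> (K * exp (- (?a * \<bar>r\<bar>))) * norm (Complex r ?s - Complex r 0)"
      unfolding side_def
    proof (rule contour_integral_bound_linepath)
      show "?f contour_integrable_on linepath (Complex r 0) (Complex r ?s)"
        using r seg by (intro contour_integrable_continuous_linepath continuous_on_subset[OF contf] subsetI in_strip) auto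
      show "0 \<le> K * exp (- (?a * \<bar>r\<bar>))"
        by (simp add: K_def sum_nonneg)
      fix z assume "z \<in> closed_segment (Complex r 0) (Complex r ?s)"
      then show "norm (?f z) \<le> K * exp (- (?a * \<bar>r\<bar>))"
        using norm_strip_fun_le[OF assms, of z \<xi>] seg[of z] r unfolding K_def by simp
    qed
    moreover have "norm (Complex r ?s - Complex r 0) = ?s" by (simp add: cmod_def)
    ultimately show ?thesis by simp
  qed
  have top: "filterlim (\<lambda>n. ?a * real n) at_top sequentially"
    by (rule filterlim_tendsto_pos_mult_at_top[OF tendsto_const a filterlim_real_sequentially])
  then have "filterlim (\<lambda>n. exp (?a * real n)) at_top sequentially"
    by (rule filterlim_compose[OF exp_at_top])
  then have "\<forall>\<^sub>F n in sequentially. exp (?a * real n) \<ge> 2"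
    by (simp add: filterlim_at_top)
  \<comment> \<open>The threshold 2 is the one in the decay bound; \<open>n > 0\<close> gives a
    genuine rectangle.\<close>
  then have ev: "\<forall>\<^sub>F n in sequentially. exp (?a * real n) \<ge> 2 \<and> n > 0"
    by (intro eventually_conj eventually_gt_at_top)
  have "filterlim (\<lambda>n. - (?a * real n)) at_bot sequentially"
    using top by (simp add: filterlim_uminus_at_bot)
  then have "(\<lambda>n. exp (- (?a * real n))) \<longlonglongrightarrow> 0"
    by (rule filterlim_compose[OF exp_at_bot])
  then have bound0: "(\<lambda>n. K * exp (- (?a * real n)) * ?s) \<longlonglongrightarrow> 0"
    by (intro tendsto_mult_left_zero tendsto_mult_right_zero)
  have "(\<lambda>n. side (real n)) \<longlonglongrightarrow> 0" "(\<lambda>n. side (- real n)) \<longlonglongrightarrow> 0"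
    by (rule Lim_null_comparison[OF eventually_mono[OF ev] bound0]; use side_bound[of "real _"] side_bound[of "- real _"] in simp)+
  then have "(\<lambda>n. (1 - ?E) * integral {- real n..real n} h + (side (real n) - side (- real n)))
      \<longlonglongrightarrow> (1 - ?E) * integral\<^sup>L lborel h + (0 - 0)"
    by (intro tendsto_intros tendsto_integral_symmetric_interval h_int)
  \<comment> \<open>By the residue theorem the sequence equals \<open>?C\<close> for every positive
    \<open>n\<close>.\<close>
  moreover have "(\<lambda>n. (1 - ?E) * integral {- real n..real n} h + (side (real n) - side (- real n))) \<longlonglongrightarrow> ?C"
    by (rule tendsto_eventually, rule eventually_mono[OF ev]) (use rect in auto)
  ultimately show ?thesis
    unfolding fourier_h using LIMSEQ_unique by fastforce
qed

text \<open>For \<open>\<xi> \<noteq> 0\<close> the factor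
  \<open>1 - exp (2 pi \<xi> sqrt N)\<close> can be divided out. Both sides are continuous at 0, so
  the equality extends to that point.\<close>

lemma fourier_Phi:
  assumes "x \<in> X_space N" "N > 0"
  shows "fourier (Phi N x) \<xi> = - \<i> * Phi N (dft N (reflect N x)) \<xi>"
proof -
  let ?y = "dft N (reflect N x)"
  have nonzero: "fourier (Phi N x) \<xi> = - \<i> * Phi N ?y \<xi>" if "\<xi> \<noteq> 0" for \<xi>
  proof -
    have "1 - exp (2 * pi * \<xi> * sqrt N) \<noteq> 0" using that assms(2) by simp
    then have "complex_of_real (1 - exp (2 * pi * \<xi> * sqrt N)) \<noteq> 0" by (simp only: of_real_eq_0_iff not_False_eq_True)
    then show ?thesis
      using fourier_Phi_times[OF assms, of \<xi>] that
      by (simp add: Phi_def Phi_quot_def field_simps)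
  qed
  show ?thesis
  proof (cases "\<xi> = 0")
    case True
    have "isCont (Phi N ?y) 0"
      using continuous_on_Phi[OF dft_reflect_in_X_space[OF assms(1)] assms(2)]
      by (simp add: continuous_on_eq_continuous_at)
    then have "((\<lambda>\<xi>. - \<i> * Phi N ?y \<xi>) \<longlongrightarrow> - \<i> * Phi N ?y 0) (at 0)"
      unfolding isCont_def by (intro tendsto_intros)
    then have "(fourier (Phi N x) \<longlongrightarrow> - \<i> * Phi N ?y 0) (at 0)"
      by (rule Lim_transform_eventually) (auto simp: eventually_at_filter nonzero)
    moreover have "(fourier (Phi N x) \<longlongrightarrow> fourier (Phi N x) 0) (at 0)"
      using isCont_fourier[OF integrable_Phi[OF assms]] by (simp add: isCont_def)
    ultimately show ?thesis
      unfolding True by (intro tendsto_unique[rotated]) auto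
  qed (rule nonzero)
qed

theorem theorem2p5:
  fixes N :: nat and x :: "nat \<Rightarrow> complex"
  assumes "N \<ge> 2" and "x \<in> X_space N"
  shows "integrable lborel (Phi N x)
    \<and> fourier (Phi N x) = (\<lambda>\<xi>. - \<i> * Phi N (dft N (reflect N x)) \<xi>)
    \<and> (\<lambda>\<xi>. - \<i> * Phi N (dft N (reflect N x)) \<xi>) = (\<lambda>\<xi>. - \<i> * Phi N (dft_inv N x) \<xi>)"
  using assms by (auto simp: integrable_Phi fourier_Phi dft_inv_eq)

end
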